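(* Let $n\in\mathbb{N}$ and let $\Gamma=\bigcup_{i=1}^n\Gamma_i$ be an $n$-star-shaped graph in $\mathbb{R}^N$ with edges $\Gamma_i=[A_0,A_i]$, lengths $\ell_i$, unit vectors $\tau_i=(A_i-A_0)/\ell_i$ and first eigenvalue $\lambda_1$. Then $\Gamma$ satisfies the case of equality in the Reilly inequality $$\lambda_1\sum_{i=1}^n\ell_i\leqslant n+\left|\sum_{i=1}^n\tau_i\right|^2,$$ that is, $\lambda_1\sum_{i=1}^n\ell_i= n+\left|\sum_{i=1}^n\tau_i\right|^2$, if and only if $A_0=0$, all the vertices $A_1,\dots,A_n$ belong to the same circle of radius $1/\lambda_1$, and $A_0$ is stationary, namely $\sum_{i=1}^n\tau_i=0$.
   Context: An $n$-star-shaped graph is the union of $n$ segments $\Gamma_i=[A_0,A_i]$ of $\mathbb{R}^N$, $1\leqslant i\leqslant n$, such that there do not exist two indices $i$ and $j$ for which $\Gamma_i\subset\Gamma_j$. The length of the edge $\Gamma_i$ is $\ell_i=|A_i-A_0|$. The first eigenvalue $\lambda_1>0$ of $\Gamma$ is defined by $$\lambda_1:=\inf_{u\in C^\infty(\mathbb{R}^N)\setminus\{0\}\ \text{s.t.}\ \sum_{i=0}^n u(A_i)=0}\left(\sum_{i=0}^n u(A_i)^2\right)^{-1}\sum_{i=1}^n\int_{\Gamma_i}|\nabla_{\mathbb{R}\tau_i}u|^2\,dx,$$ where $\nabla_{\mathbb{R}\tau_i}u$ is the orthogonal projection of $\nabla u$ onto the line $\mathbb{R}\tau_i$ and $dx$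 is the length element on $\Gamma_i$.
   Formalization: As stated, equality is translation invariant but A_0=0 is not, and for n=1 equality always holds with τ_1≠0; so n≥2 is assumed, and A_0=0 is claimed if the vertices sum to zero, or in general after a translation. The circle is read as the sphere centred at A_0. *)

theory Defs
  imports "HOL-Analysis.Analysis"
begin

primrec Ck_fun :: "nat \<Rightarrow> ('a::euclidean_space \<Rightarrow> real) \<Rightarrow> bool" where
  "Ck_fun 0 u \<longleftrightarrow> continuous_on UNIV u"
| "Ck_fun (Suc k) u \<longleftrightarrow>
     (\<forall>x. u differentiable (at x)) \<and>
     (\<forall>b\<in>Basis. Ck_fun k (\<lambda>x. frechet_derivative u (at x) b))"

definition smooth_fun :: "('a::euclidean_space \<Rightarrow> real) \<Rightarrow> bool" where
  "smooth_fun u \<longleftrightarrow> (\<forall>k. Ck_fun k u)"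

definition grad :: "('a::euclidean_space \<Rightarrow> real) \<Rightarrow> 'a \<Rightarrow> 'a" where
  "grad u x = (\<Sum>b\<in>Basis. frechet_derivative u (at x) b *\<^sub>R b)"

definition line_proj :: "'a::euclidean_space \<Rightarrow> 'a \<Rightarrow> 'a" where
  "line_proj t w = ((w \<bullet> t) / (t \<bullet> t)) *\<^sub>R t"

text \<open>
  A star-shaped graph with \<open>n\<close> edges is given by its centre \<open>A 0\<close> and its outer vertices
  \<open>A 1, \<dots>, A n\<close>; the values of \<open>A\<close> beyond \<open>n\<close> are irrelevant.
\<close>

definition edge :: "(nat \<Rightarrow> 'a::euclidean_space) \<Rightarrow> nat \<Rightarrow> 'a set" where
  "edge A i = closed_segment (A 0) (A i)"

definition edge_length :: "(nat \<Rightarrow> 'a::euclidean_space) \<Rightarrow> nat \<Rightarrow> real" where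
  "edge_length A i = norm (A i - A 0)"

definition edge_dir :: "(nat \<Rightarrow> 'a::euclidean_space) \<Rightarrow> nat \<Rightarrow> 'a" where
  "edge_dir A i = (A i - A 0) /\<^sub>R edge_length A i"

text \<open>
  The condition \<open>A i \<noteq> A 0\<close> (edges are nondegenerate, so that their unit vectors exist) follows
  from the second one if \<open>n \<ge> 2\<close>; it is needed only for \<open>n = 1\<close>.
\<close>

definition star_shaped_graph :: "nat \<Rightarrow> (nat \<Rightarrow> 'a::euclidean_space) \<Rightarrow> bool" where
  "star_shaped_graph n A \<longleftrightarrow>
     (\<forall>i\<in>{1..n}. A i \<noteq> A 0) \<and>
     (\<forall>i\<in>{1..n}. \<forall>j\<in>{1..n}. i \<noteq> j \<longrightarrow> \<not> edge A i \<subseteq> edge A j)"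

text \<open>The length element on an edge is expressed through the arc-length parametrisation.\<close>

definition edge_integral :: "(nat \<Rightarrow> 'a::euclidean_space) \<Rightarrow> nat \<Rightarrow> ('a \<Rightarrow> real) \<Rightarrow> real" where
  "edge_integral A i f = integral {0..edge_length A i} (\<lambda>s. f (A 0 + s *\<^sub>R edge_dir A i))"

definition dirichlet_energy :: "nat \<Rightarrow> (nat \<Rightarrow> 'a::euclidean_space) \<Rightarrow> ('a \<Rightarrow> real) \<Rightarrow> real" where
  "dirichlet_energy n A u =
     (\<Sum>i=1..n. edge_integral A i (\<lambda>x. (norm (line_proj (edge_dir A i) (grad u x)))\<^sup>2))"

text \<open>
  A test function has to be nonzero at some vertex, for the quotient to make sense; without this
  restriction, \<open>x / 0 = 0\<close> would force the infimum to be \<open>0\<close>.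
\<close>

definition first_eigenvalue :: "nat \<Rightarrow> (nat \<Rightarrow> 'a::euclidean_space) \<Rightarrow> real" where
  "first_eigenvalue n A =
     Inf {dirichlet_energy n A u / (\<Sum>i=0..n. (u (A i))\<^sup>2) |u.
            smooth_fun u \<and> (\<Sum>i=0..n. u (A i)) = 0 \<and> (\<Sum>i=0..n. (u (A i))\<^sup>2) \<noteq> 0}"

end

(*
  Proof idea.  Let c be the centre of mass of the vertices.  Testing the first eigenvalue with the
  coordinate functions of x - c and summing gives

    lambda_1 * sum_{i=0}^n |A_i - c|^2 <= sum_{i=1}^n l_i.

  Put v_0 = - sum_i tau_i, v_i = tau_i and k = 1 / lambda_1.  Since sum_{i=0}^n (A_i - c) . v_i
  is the total length, equality in the Reilly inequality makes the sum of |A_i - c - k v_i|^2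
  nonpositive, so A_i - c = k v_i for all i.  Then A_0 - c = (k - l_i) tau_i for every i >= 1; if
  A_0 were different from c, all directions would be collinear, hence n = 2 and tau_1 = - tau_2,
  which forces v_0 = 0 and thus A_0 = c after all.  The converse is immediate from l_i = 1 / lambda_1.
*)
theory Submission
  imports Defs
begin

section \<open>Affine test functions\<close>

lemma Ck_fun_const: "Ck_fun k (\<lambda>x::'a::euclidean_space. r)"
  by (induction k arbitrary: r) (simp_all add: frechet_derivative_const)

lemma has_derivative_affine:
  "((\<lambda>x::'a::euclidean_space. (x - c) \<bullet> e) has_derivative (\<lambda>h. h \<bullet> e)) (at x)"
  by (auto intro!: derivative_eq_intros)

lemma frechet_derivative_affine:
  "frechet_derivative (\<lambda>x::'a::euclidean_space. (x - c) \<bullet> e) (at x) = (\<lambda>h. h \<bullet> e)"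
  by (rule frechet_derivative_at [OF has_derivative_affine, symmetric])

lemma smooth_fun_affine: "smooth_fun (\<lambda>x::'a::euclidean_space. (x - c) \<bullet> e)"
proof -
  have "Ck_fun k (\<lambda>x. (x - c) \<bullet> e)" for k
  proof (cases k)
    case 0
    then show ?thesis by (auto intro!: continuous_intros)
  next
    \<comment> \<open>No induction on \<open>k\<close> is needed: the partial derivatives are
      constants, hence of every class.\<close>
    case (Suc m)
    have "(\<lambda>x. (x - c) \<bullet> e) differentiable (at x)" for x
      using has_derivative_affine differentiable_def by blast
    then show ?thesis
      by (simp add: Suc frechet_derivative_affine Ck_fun_const)
  qed
  then show ?thesis by (simp add: smooth_fun_def)
qed

lemma grad_affine: "grad (\<lambda>x::'a::euclidean_space. (x - c) \<bullet> e) x = e"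
  unfolding grad_def frechet_derivative_affine
  by (simp only: inner_commute [of _ e] euclidean_representation)

section \<open>Energy of affine functions and the bound on the moment of inertia\<close>

lemma norm_edge_dir: "A i \<noteq> A 0 \<Longrightarrow> norm (edge_dir A i) = 1"
  by (simp add: edge_dir_def edge_length_def)

lemma edge_vector: "A i - A 0 = edge_length A i *\<^sub>R edge_dir A i"
  by (cases "A i = A 0") (simp_all add: edge_dir_def edge_length_def)

lemma edge_length_nonneg: "0 \<le> edge_length A i"
  by (simp add: edge_length_def)

lemma edge_integral_nonneg:
  assumes "\<And>x. 0 \<le> f x"
  shows "0 \<le> edge_integral A i f"
proof (cases "(\<lambda>s. f (A 0 + s *\<^sub>R edge_dir A i)) integrable_on {0..edge_length A i}")
  case True
  then show ?thesis
    unfolding edge_integral_def by (rule integral_nonneg) (simp add: assms)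
next
  \<comment> \<open>\<open>integral\<close> takes the default value 0 here, so integrability need
    not be assumed.\<close>
  case False
  then show ?thesis by (simp add: edge_integral_def not_integrable_integral)
qed

lemma dirichlet_energy_nonneg: "0 \<le> dirichlet_energy n A u"
  unfolding dirichlet_energy_def by (intro sum_nonneg edge_integral_nonneg) simp

text \<open>The gradient is the constant \<open>e\<close>, whose projection onto the line of a unit
  vector has length \<open>\<bar>edge_dir A i \<bullet> e\<bar>\<close>; each edge integral is thus
  that of a constant.\<close>

lemma dirichlet_energy_affine:
  assumes "\<And>i. i \<in> {1..n} \<Longrightarrow> A i \<noteq> A 0"
  shows "dirichlet_energy n A (\<lambda>x. (x - c) \<bullet> e)
           = (\<Sum>i=1..n. edge_length A i * (edge_dir A i \<bullet> e)\<^sup>2)"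
  unfolding dirichlet_energy_def
proof (rule sum.cong [OF refl])
  fix i assume "i \<in> {1..n}"
  then have t: "norm (edge_dir A i) = 1" using assms norm_edge_dir by blast
  then have "edge_dir A i \<bullet> edge_dir A i = 1" by (simp add: dot_square_norm)
  with t show "edge_integral A i
      (\<lambda>x. (norm (line_proj (edge_dir A i) (grad (\<lambda>x. (x - c) \<bullet> e) x)))\<^sup>2)
    = edge_length A i * (edge_dir A i \<bullet> e)\<^sup>2"
    by (simp add: edge_integral_def grad_affine line_proj_def inner_commute [of e] edge_length_nonneg)
qed

text \<open>The product form also covers functions vanishing at all vertices, which the infimum
  excludes. A coordinate function is of this kind when the graph lies in a hyperplane.\<close>

lemma first_eigenvalue_mult_le:
  assumes "smooth_fun u" "(\<Sum>i=0..n. u (A i)) = 0"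
  shows "first_eigenvalue n A * (\<Sum>i=0..n. (u (A i))\<^sup>2) \<le> dirichlet_energy n A u"
proof (cases "(\<Sum>i=0..n. (u (A i))\<^sup>2) = 0")
  case True
  then show ?thesis by (simp add: dirichlet_energy_nonneg)
next
  case False
  then have pos: "0 < (\<Sum>i=0..n. (u (A i))\<^sup>2)"
    using sum_nonneg [of "{0..n}" "\<lambda>i. (u (A i))\<^sup>2"] by simp
  have "first_eigenvalue n A \<le> dirichlet_energy n A u / (\<Sum>i=0..n. (u (A i))\<^sup>2)"
    unfolding first_eigenvalue_def
  proof (rule cInf_lower)
    \<comment> \<open>On the reals \<open>Inf\<close> is a lower bound only for sets bounded below;
      nonnegativity of the energy supplies the bound 0.\<close>
    show "bdd_below {dirichlet_energy n A u / (\<Sum>i=0..n. (u (A i))\<^sup>2) |u.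
            smooth_fun u \<and> (\<Sum>i=0..n. u (A i)) = 0 \<and> (\<Sum>i=0..n. (u (A i))\<^sup>2) \<noteq> 0}"
      by (rule bdd_belowI [where m = 0])
        (auto intro!: divide_nonneg_nonneg sum_nonneg simp: dirichlet_energy_nonneg)
  qed (use assms False in blast)
  then show ?thesis by (simp only: pos_le_divide_eq [OF pos])
qed

lemma sum_Basis_inner_square: "(\<Sum>e\<in>Basis. (x \<bullet> e)\<^sup>2) = (norm x)\<^sup>2"
  unfolding power2_norm_eq_inner euclidean_inner [of x x] by (simp add: power2_eq_square)

lemma first_eigenvalue_mult_inertia_le:
  assumes star: "star_shaped_graph n A"
    and centre: "(\<Sum>i=0..n. A i - c) = 0"
  shows "first_eigenvalue n A * (\<Sum>i=0..n. (norm (A i - c))\<^sup>2) \<le> (\<Sum>i=1..n. edge_length A i)"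
proof -
  have ne: "A i \<noteq> A 0" if "i \<in> {1..n}" for i
    using star that by (simp add: star_shaped_graph_def)
  have "first_eigenvalue n A * (\<Sum>i=0..n. (norm (A i - c))\<^sup>2)
      = (\<Sum>e\<in>Basis. first_eigenvalue n A * (\<Sum>i=0..n. ((A i - c) \<bullet> e)\<^sup>2))"
    unfolding sum_distrib_left [symmetric] sum_Basis_inner_square [symmetric]
    by (subst sum.swap) (rule refl)
  also have "\<dots> \<le> (\<Sum>e\<in>Basis. dirichlet_energy n A (\<lambda>x. (x - c) \<bullet> e))"
  proof (intro sum_mono first_eigenvalue_mult_le smooth_fun_affine)
    \<comment> \<open>The choice of \<open>c\<close> makes each coordinate function of
      \<open>x - c\<close> admissible.\<close>
    fix e :: 'a
    show "(\<Sum>i=0..n. (A i - c) \<bullet> e) = 0"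
      using centre by (simp only: inner_sum_left [symmetric] inner_zero_left)
  qed
  also have "\<dots> = (\<Sum>i=1..n. edge_length A i * (\<Sum>e\<in>Basis. (edge_dir A i \<bullet> e)\<^sup>2))"
    by (simp only: dirichlet_energy_affine [where A = A and n = n, OF ne] sum_distrib_left) (rule sum.swap)
  \<comment> \<open>The squared coordinates of a unit vector sum to 1.\<close>
  also have "\<dots> = (\<Sum>i=1..n. edge_length A i)"
    by (intro sum.cong refl) (simp add: sum_Basis_inner_square norm_edge_dir ne)
  finally show ?thesis .
qed

section \<open>Directions of the edges\<close>

lemma edge_subset:
  assumes "edge_dir A i = edge_dir A j" "edge_length A i \<le> edge_length A j"
  shows "edge A i \<subseteq> edge A j"
proof (cases "edge_length A j = 0")
  case True
  then have "A i = A 0"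
    using assms(2) by (simp add: edge_length_def)
  then show ?thesis by (simp add: edge_def)
next
  case False
  define t where "t = edge_length A i / edge_length A j"
  have t: "0 \<le> t" "t \<le> 1"
    using assms(2) edge_length_nonneg [of A i] edge_length_nonneg [of A j] False
    by (auto simp: t_def divide_le_eq)
  have "A i - A 0 = t *\<^sub>R (A j - A 0)"
    using assms(1) False by (simp add: t_def edge_vector [of A i] edge_vector [of A j])
  then have "A i = (1 - t) *\<^sub>R A 0 + t *\<^sub>R A j"
    by (simp add: algebra_simps)
  with t have "A i \<in> closed_segment (A 0) (A j)"
    by (auto simp: closed_segment_def)
  then show ?thesis
    by (simp add: edge_def subset_closed_segment)
qed

text \<open>Of two edges with the same direction the shorter lies in the longer, which the
  definition of a star-shaped graph forbids.\<close>

lemma inj_on_edge_dir: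
  assumes "star_shaped_graph n A"
  shows "inj_on (edge_dir A) {1..n}"
proof (rule inj_onI, rule ccontr)
  fix i j assume ij: "i \<in> {1..n}" "j \<in> {1..n}" "edge_dir A i = edge_dir A j" "i \<noteq> j"
  then have "edge A i \<subseteq> edge A j \<or> edge A j \<subseteq> edge A i"
    using edge_subset [of A i j] edge_subset [of A j i] by force
  then show False
    using assms ij unfolding star_shaped_graph_def by metis
qed

text \<open>Each vector is \<open>sgn w\<close> or \<open>- sgn w\<close>. By injectivity and
  \<open>n \<ge> 2\<close> both occur, each exactly once, and they cancel.\<close>

lemma sum_collinear_unit_vectors:
  fixes w :: "'a::euclidean_space" and \<tau> :: "nat \<Rightarrow> 'a"
  assumes "n \<ge> 2" and inj: "inj_on \<tau> {1..n}"
    and unit: "\<And>i. i \<in> {1..n} \<Longrightarrow> norm (\<tau> i) = 1"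
    and coll: "\<And>i. i \<in> {1..n} \<Longrightarrow> w = r i *\<^sub>R \<tau> i"
    and "w \<noteq> 0"
  shows "(\<Sum>i=1..n. \<tau> i) = 0"
proof -
  have two: "\<tau> i = sgn w \<or> \<tau> i = - sgn w" if "i \<in> {1..n}" for i
  proof -
    have "sgn w = sgn (r i) *\<^sub>R \<tau> i"
      using coll [OF that] unit [OF that] by (simp add: sgn_scaleR sgn_div_norm)
    moreover have "r i \<noteq> 0" using coll [OF that] \<open>w \<noteq> 0\<close> by auto
    ultimately show ?thesis by (cases "r i > 0") auto
  qed
  have neg: "sgn w \<noteq> - sgn w"
  proof
    assume "sgn w = - sgn w"
    then have "2 *\<^sub>R sgn w = 0" by (simp only: scaleR_2 eq_neg_iff_add_eq_0)
    with \<open>w \<noteq> 0\<close> show False by (simp add: sgn_zero_iff)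
  qed
  have sub: "\<tau> ` {1..n} \<subseteq> {sgn w, - sgn w}" using two by blast
  have "card (\<tau> ` {1..n}) \<ge> card {sgn w, - sgn w}"
    using \<open>n \<ge> 2\<close> neg unfolding card_image [OF inj] by simp
  with sub have img: "\<tau> ` {1..n} = {sgn w, - sgn w}"
    by (intro card_seteq) auto
  have "(\<Sum>i=1..n. \<tau> i) = \<Sum> (\<tau> ` {1..n})"
    using sum.reindex [OF inj, of id] by simp
  also have "\<dots> = 0" unfolding img using neg by simp
  finally show ?thesis .
qed

section \<open>The case of equality\<close>

lemma norm_diff_scaleR_square:
  fixes a b :: "'a::real_inner"
  shows "(norm (a - k *\<^sub>R b))\<^sup>2 = (norm a)\<^sup>2 - 2 * k * (a \<bullet> b) + k\<^sup>2 * (norm b)\<^sup>2"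
  unfolding power2_norm_eq_inner inner_diff_left inner_diff_right inner_scaleR_left inner_scaleR_right
  by (simp add: inner_commute [of b a] power2_eq_square algebra_simps)

lemma reilly_equality_imp:
  assumes "n \<ge> 2" and star: "star_shaped_graph n A"
    and centre: "(\<Sum>i=0..n. A i - c) = 0"
    and eq: "first_eigenvalue n A * (\<Sum>i=1..n. edge_length A i)
               = real n + (norm (\<Sum>i=1..n. edge_dir A i))\<^sup>2"
  shows "A 0 = c \<and> (\<forall>i\<in>{1..n}. norm (A i - c) = 1 / first_eigenvalue n A) \<and>
         (\<Sum>i=1..n. edge_dir A i) = 0"
proof -
  define l where "l = first_eigenvalue n A"
  define L where "L = (\<Sum>i=1..n. edge_length A i)"
  define S where "S = (\<Sum>i=1..n. edge_dir A i)"
  define v where "v i = (if i = 0 then - S else edge_dir A i)" for i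
  have unit: "norm (edge_dir A i) = 1" if "i \<in> {1..n}" for i
    using star that norm_edge_dir by (metis star_shaped_graph_def)
  have eq': "l * L = real n + (norm S)\<^sup>2" using eq by (simp add: l_def L_def S_def)
  \<comment> \<open>Positivity of the eigenvalue is read off from the equality itself, whose
    right-hand side is at least \<open>n\<close>.\<close>
  then have "0 < l * L" using \<open>n \<ge> 2\<close> by (simp add: add_pos_nonneg)
  moreover have "0 \<le> L" by (simp add: L_def sum_nonneg edge_length_nonneg)
  ultimately have l: "0 < l" by (simp add: zero_less_mult_iff)
  have split: "(\<Sum>i=0..n. f i) = f 0 + (\<Sum>i=1..n. f i)" for f :: "nat \<Rightarrow> real"
    by (simp add: sum.atLeast_Suc_atMost)
  have vv: "(\<Sum>i=0..n. (norm (v i))\<^sup>2) = l * L"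
    by (simp add: split v_def eq' unit)
  have "(\<Sum>i=0..n. (A i - c) \<bullet> v i)
      = (\<Sum>i=1..n. (A i - c) \<bullet> edge_dir A i) - (A 0 - c) \<bullet> S"
    by (simp add: split v_def)
  \<comment> \<open>Distributing \<open>S\<close> over the edges replaces \<open>c\<close> by
    \<open>A 0\<close>; this dictates the choice \<open>v 0 = - S\<close>.\<close>
  also have "\<dots> = (\<Sum>i=1..n. (A i - A 0) \<bullet> edge_dir A i)"
    by (simp add: S_def inner_sum_right sum_subtractf [symmetric] inner_diff_left)
  also have "\<dots> = L"
    unfolding L_def
    by (intro sum.cong refl) (simp add: edge_vector [of A] dot_square_norm unit)
  finally have Av: "(\<Sum>i=0..n. (A i - c) \<bullet> v i) = L" .
  have "(\<Sum>i=0..n. (norm (A i - c - (1 / l) *\<^sub>R v i))\<^sup>2)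
      = (\<Sum>i=0..n. (norm (A i - c))\<^sup>2 - 2 / l * ((A i - c) \<bullet> v i) + (1 / l)\<^sup>2 * (norm (v i))\<^sup>2)"
    by (simp add: norm_diff_scaleR_square)
  also have "\<dots> = (\<Sum>i=0..n. (norm (A i - c))\<^sup>2) - 2 / l * L + (1 / l)\<^sup>2 * (l * L)"
    by (simp only: sum.distrib sum_subtractf sum_distrib_left [symmetric] vv Av)
  also have "\<dots> = (\<Sum>i=0..n. (norm (A i - c))\<^sup>2) - L / l"
    using l by (simp add: power2_eq_square)
  \<comment> \<open>The inertia bound says that the sum of squares is at most
    \<open>L / l\<close>.\<close>
  also have "\<dots> \<le> 0"
    using first_eigenvalue_mult_inertia_le [OF star centre] l
    by (simp add: l_def L_def pos_le_divide_eq mult.commute)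
  finally have "(\<Sum>i=0..n. (norm (A i - c - (1 / l) *\<^sub>R v i))\<^sup>2) = 0"
    by (intro antisym sum_nonneg) auto
  then have Ai: "A i - c = (1 / l) *\<^sub>R v i" if "i \<le> n" for i
    using that by (subst (asm) sum_nonneg_eq_0_iff) auto
  have A0: "A 0 - c = - (1 / l) *\<^sub>R S" using Ai [of 0] by (simp add: v_def)
  have Ai': "A i - c = (1 / l) *\<^sub>R edge_dir A i" if "i \<in> {1..n}" for i
    using Ai [of i] that by (simp add: v_def)
  have coll: "A 0 - c = (1 / l - edge_length A i) *\<^sub>R edge_dir A i" if "i \<in> {1..n}" for i
    using Ai' [OF that] edge_vector [of A i] by (simp add: algebra_simps)
  have "A 0 - c = 0"
  proof (rule ccontr)
    assume ne: "A 0 - c \<noteq> 0"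
    \<comment> \<open>By \<open>A0\<close>, a vanishing \<open>S\<close> contradicts
      \<open>ne\<close>.\<close>
    have "S = 0"
      unfolding S_def
      using sum_collinear_unit_vectors [OF \<open>n \<ge> 2\<close> inj_on_edge_dir [OF star] unit coll ne] .
    with A0 ne show False by simp
  qed
  moreover from this A0 l have "S = 0" by simp
  moreover have "\<forall>i\<in>{1..n}. norm (A i - c) = 1 / l"
    using Ai' unit l by simp
  ultimately show ?thesis by (simp add: S_def l_def)
qed

text \<open>Every edge has length \<open>1 / first_eigenvalue n A\<close> and so contributes 1 to
  the left-hand side.\<close>

lemma reilly_equality_if:
  assumes "n \<ge> 1" and star: "star_shaped_graph n A"
    and radius: "\<forall>i\<in>{1..n}. norm (A i - A 0) = 1 / first_eigenvalue n A"
    and stationary: "(\<Sum>i=1..n. edge_dir A i) = 0"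
  shows "first_eigenvalue n A * (\<Sum>i=1..n. edge_length A i)
           = real n + (norm (\<Sum>i=1..n. edge_dir A i))\<^sup>2"
proof -
  \<comment> \<open>A nondegenerate edge rules out a zero eigenvalue, for which
    \<open>1 / 0 = 0\<close> would be the radius.\<close>
  have "A 1 \<noteq> A 0" using star \<open>n \<ge> 1\<close> by (simp add: star_shaped_graph_def)
  moreover have "norm (A 1 - A 0) = 1 / first_eigenvalue n A"
    using radius \<open>n \<ge> 1\<close> by simp
  ultimately have "first_eigenvalue n A \<noteq> 0" by auto
  then show ?thesis
    unfolding stationary using radius by (simp add: edge_length_def)
qed

text \<open>The condition \<open>A 0 = 0\<close> presupposes that the centre of mass is the origin,
  whereas the equality is invariant under translation; the second conjunct therefore allows an
  arbitrary centre \<open>c\<close>. For \<open>n = 1\<close> the equality always holds although the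
  single direction is nonzero, whence \<open>n \<ge> 2\<close>.\<close>

theorem proposition5p4:
  fixes n :: nat and A :: "nat \<Rightarrow> real ^ 'N"
  assumes "n \<ge> 2"
    and "star_shaped_graph n A"
  shows
    "((\<Sum>i=0..n. A i) = 0 \<longrightarrow>
        (first_eigenvalue n A * (\<Sum>i=1..n. edge_length A i)
           = real n + (norm (\<Sum>i=1..n. edge_dir A i))\<^sup>2
         \<longleftrightarrow>
         A 0 = 0 \<and>
         (\<forall>i\<in>{1..n}. A i \<in> sphere 0 (1 / first_eigenvalue n A)) \<and>
         (\<Sum>i=1..n. edge_dir A i) = 0))
     \<and>
     (first_eigenvalue n A * (\<Sum>i=1..n. edge_length A i)
        = real n + (norm (\<Sum>i=1..n. edge_dir A i))\<^sup>2
      \<longleftrightarrow>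
      (\<exists>c. A 0 - c = 0 \<and>
         (\<forall>i\<in>{1..n}. A i - c \<in> sphere 0 (1 / first_eigenvalue n A)) \<and>
         (\<Sum>i=1..n. edge_dir A i) = 0))"
    (is "(_ \<longrightarrow> (?eq \<longleftrightarrow> ?centred)) \<and> (?eq \<longleftrightarrow> ?translated)")
proof -
  have "n \<ge> 1" using assms(1) by simp
  note imp = reilly_equality_imp [OF assms]
  note "if" = reilly_equality_if [OF \<open>n \<ge> 1\<close> assms(2)]
  have "?eq \<longleftrightarrow> ?centred" if "(\<Sum>i=0..n. A i) = 0"
  proof
    assume ?eq
    then show ?centred using imp [of 0] that by simp
  next
    assume ?centred
    then show ?eq by (intro "if") simp_all
  qed
  moreover have "?eq \<longleftrightarrow> ?translated"
  proof
    assume eq: ?eq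
    \<comment> \<open>The centre of mass of all \<open>n + 1\<close> vertices, \<open>A 0\<close>
      included.\<close>
    define c where "c = (\<Sum>i=0..n. A i) /\<^sub>R real (n + 1)"
    have "(\<Sum>i=0..n. A i - c) = 0"
      by (simp add: sum_subtractf c_def sum_constant_scaleR del: sum_constant of_nat_Suc of_nat_add)
    then show ?translated using imp [OF _ eq] by (intro exI [of _ c]) simp
  next
    assume ?translated
    then show ?eq by (intro "if") auto
  qed
  ultimately show ?thesis by blast
qed

end
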